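(* Let $\psi$ be an Orlicz function, let $X$ be a random variable with values in a Banach space such that $\|X\|_\psi<\infty$, and let $X_1,X_2,\ldots$ be i.i.d. copies of $X$. Then $$\widehat{\sigma}_\psi(X_1,\ldots,X_n)\longrightarrow \sigma_\psi=\|X\|_\psi\qquad\text{almost surely as } n\to\infty .$$
   Context: An Orlicz function is a function $\psi:[0,\infty)\to[0,\infty)$ that is increasing and convex, with $\psi(0)=0$ and $\psi(x)\to\infty$ as $x\to\infty$. For a random variable $X$ taking values in a Banach space with norm $|\cdot|$, the Orlicz norm is $\|X\|_\psi=\inf\{\sigma>0 : \mathbb{E}\,\psi(|X|/\sigma)\le 1\}$ (with $\inf\emptyset=\infty$). The empirical Orlicz norm of a sample $X_1,\ldots,X_n$ is $$\widehat{\sigma}_\psi(X_1,\ldots,X_n)=\inf\Big\{\sigma>0 : \frac1n\sum_{i=1}^n\psi\Big(\frac{|X_i|}{\sigma}\Big)\le 1\Big\}.$$ *)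

theory Defs
  imports "HOL-Probability.Probability"
begin

text \<open>
  An Orlicz function is a total function on the reals of which only the values on
  \<open>[0,\<infinity>)\<close> matter. \<open>Increasing\<close> is read in the weak sense, so that an Orlicz function
  may vanish near 0.
\<close>

definition orlicz_function :: "(real \<Rightarrow> real) \<Rightarrow> bool" where
  "orlicz_function \<psi> \<longleftrightarrow>
     (\<forall>x\<ge>0. \<psi> x \<ge> 0) \<and> mono_on {0..} \<psi> \<and> convex_on {0..} \<psi> \<and> \<psi> 0 = 0 \<and>
     filterlim \<psi> at_top at_top"

text \<open>
  Both norms take values in the extended nonnegative reals, where the infimum of the
  empty set is \<open>\<infinity>\<close>. The expectation of the nonnegative variable \<open>\<psi> (|X| / \<sigma>)\<close> is a
  nonnegative Lebesgue integral, which is \<open>\<infinity>\<close> when the variable is not integrable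
  (the Bochner integral would be 0 there).
\<close>

definition orlicz_norm ::
    "(real \<Rightarrow> real) \<Rightarrow> 'a measure \<Rightarrow> ('a \<Rightarrow> 'b::real_normed_vector) \<Rightarrow> ennreal" where
  "orlicz_norm \<psi> M X =
     Inf {ennreal \<sigma> | \<sigma>. \<sigma> > 0 \<and> (\<integral>\<^sup>+ \<omega>. ennreal (\<psi> (norm (X \<omega>) / \<sigma>)) \<partial>M) \<le> 1}"

text \<open>The sample of size \<open>n\<close> consists of \<open>x 0, \<dots>, x (n - 1)\<close>.\<close>

definition empirical_orlicz_norm ::
    "(real \<Rightarrow> real) \<Rightarrow> nat \<Rightarrow> (nat \<Rightarrow> 'b::real_normed_vector) \<Rightarrow> ennreal" where
  "empirical_orlicz_norm \<psi> n x =
     Inf {ennreal \<sigma> | \<sigma>. \<sigma> > 0 \<and> (1 / real n) * (\<Sum>i<n. \<psi> (norm (x i) / \<sigma>)) \<le> 1}"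

end

theory Submission
  imports Defs
begin

text \<open>
  If \<open>\<sigma> > \<parallel>X\<parallel>\<close> then \<open>E \<psi>(|X|/\<sigma>) < 1\<close>, because convexity and \<open>\<psi> 0 = 0\<close> give
  \<open>\<psi> (t x) \<le> t \<psi> x\<close> for \<open>t \<le> 1\<close>; if \<open>0 < \<sigma> < \<parallel>X\<parallel>\<close> then \<open>E \<psi>(|X|/\<sigma>) > 1\<close>, possibly
  infinite. By the strong law of large numbers the sample means of \<open>\<psi>(|X\<^sub>i|/\<sigma>)\<close> are eventually
  on the same side of 1, almost surely for all rational \<open>\<sigma>\<close> at once, and this traps the
  empirical norm.

  The strong law is obtained by truncation: bounded variables are handled by Hoeffding's inequality
  and the Borel--Cantelli lemma, and for the upper bound the excess over the truncation level,
  which has small mean, is controlled by a maximal inequality of ergodic type.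
\<close>

section \<open>Strong law of large numbers for nonnegative variables\<close>

text \<open>The cap \<open>N\<close> makes every window that starts below \<open>K\<close> end
  before \<open>K + N\<close>; it is sent to infinity in the maximal inequality, whose event is
  membership of 0 without the cap.\<close>

definition heavy_starts :: "(nat \<Rightarrow> real) \<Rightarrow> real \<Rightarrow> nat \<Rightarrow> nat set" where
  "heavy_starts y c N = {i. \<exists>n\<in>{1..N}. c * real n < (\<Sum>j<n. y (i + j))}"

text \<open>
  Greedy covering: scan from \<open>i\<close> to the right, and at a heavy start skip the whole window that
  witnesses it. The windows used are disjoint and cover all heavy starts.
\<close>

lemma card_heavy_starts_le:
  fixes y :: "nat \<Rightarrow> real"
  assumes nonneg: "\<And>i. 0 \<le> y i" and "0 \<le> c"
  shows "c * card (heavy_starts y c N \<inter> {i..<K}) \<le> (\<Sum>j\<in>{i..<K + N}. y j)"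
proof (induction "K - i" arbitrary: i rule: less_induct)
  case less
  let ?B = "heavy_starts y c N"
  consider "K \<le> i" | "i < K" "i \<notin> ?B" | "i < K" "i \<in> ?B" by linarith
  then show ?case
  proof cases
    case 1
    then show ?thesis by (simp add: sum_nonneg nonneg)
  next
    case 2
    then have "?B \<inter> {i..<K} = ?B \<inter> {Suc i..<K}"
      by (auto simp: Suc_le_eq le_less)
    moreover have "c * card (?B \<inter> {Suc i..<K}) \<le> (\<Sum>j\<in>{Suc i..<K + N}. y j)"
      using 2 by (intro less) auto
    moreover have "(\<Sum>j\<in>{i..<K + N}. y j) = y i + (\<Sum>j\<in>{Suc i..<K + N}. y j)"
      using 2 by (intro sum.atLeast_Suc_lessThan) auto
    ultimately show ?thesis using nonneg[of i] by simp
  next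
    case 3
    then obtain n where n: "1 \<le> n" "n \<le> N" "c * real n < (\<Sum>j<n. y (i + j))"
      by (auto simp: heavy_starts_def)
    \<comment> \<open>The skipped window contains at most \<open>n\<close> heavy starts, and
      \<open>c * n\<close> is paid for by its own sum. Since \<open>i < K\<close> and
      \<open>n \<le> N\<close>, it ends by \<open>K + N\<close>.\<close>
    have "card (?B \<inter> {i..<K}) \<le> card ({i..<i + n} \<union> (?B \<inter> {i + n..<K}))"
      by (intro card_mono) auto
    also have "\<dots> \<le> n + card (?B \<inter> {i + n..<K})"
      using card_Un_le[of "{i..<i + n}"] by simp
    finally have "c * card (?B \<inter> {i..<K}) \<le> c * (n + card (?B \<inter> {i + n..<K}))"
      using \<open>0 \<le> c\<close> by (intro mult_left_mono) auto
    moreover have "c * card (?B \<inter> {i + n..<K}) \<le> (\<Sum>j\<in>{i + n..<K + N}. y j)"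
      using 3 n by (intro less) auto
    moreover have "(\<Sum>j<n. y (i + j)) = (\<Sum>j\<in>{i..<i + n}. y j)"
      using sum.shift_bounds_nat_ivl[of y 0 i n] by (simp add: lessThan_atLeast0 add.commute)
    moreover have "(\<Sum>j\<in>{i..<K + N}. y j) = (\<Sum>j\<in>{i..<i + n}. y j) + (\<Sum>j\<in>{i + n..<K + N}. y j)"
      using 3 n by (intro sum.atLeastLessThan_concat[symmetric]) auto
    ultimately show ?thesis using n by (simp add: distrib_left)
  qed
qed

section \<open>Stationarity of i.i.d. sequences and the maximal inequality\<close>

locale iid_nonneg = prob_space M for M :: "'a measure" +
  fixes Y :: "nat \<Rightarrow> 'a \<Rightarrow> real"
  assumes indep: "indep_vars (\<lambda>_. borel) Y UNIV"
    and distr_Y: "distr M borel (Y i) = distr M borel (Y 0)"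
    and nonneg: "0 \<le> Y i \<omega>"
begin

lemma measurable_Y [measurable]: "random_variable borel (Y i)"
  using indep by (auto simp: indep_vars_def)

text \<open>Serves to pass to the truncations \<open>min x T\<close> and to the excesses
  \<open>x - min x T\<close>.\<close>

lemma iid_nonneg_compose:
  assumes [measurable]: "f \<in> borel_measurable borel" and "\<And>x. 0 \<le> x \<Longrightarrow> 0 \<le> f x"
  shows "iid_nonneg M (\<lambda>i \<omega>. f (Y i \<omega>))"
proof
  show "indep_vars (\<lambda>_. borel) (\<lambda>i \<omega>. f (Y i \<omega>)) UNIV"
    by (rule indep_vars_compose2[OF indep]) simp
  show "distr M borel (\<lambda>\<omega>. f (Y i \<omega>)) = distr M borel (\<lambda>\<omega>. f (Y 0 \<omega>))" for i
    using arg_cong[OF distr_Y, of "\<lambda>D. distr D borel f" i] by (simp add: distr_distr comp_def)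
qed (simp add: assms nonneg)

text \<open>Stationarity: the joint law of an independent sequence is the product of its marginals,
  which are all equal here. Whole sequences are compared because a heavy start depends on several
  coordinates jointly.\<close>

lemma distr_shift:
  "distr M (\<Pi>\<^sub>M j\<in>UNIV. borel) (\<lambda>\<omega> j. Y (i + j) \<omega>) = distr M (\<Pi>\<^sub>M j\<in>UNIV. borel) (\<lambda>\<omega> j. Y j \<omega>)"
proof -
  have "indep_vars (\<lambda>_. borel) (\<lambda>j. Y (i + j)) UNIV"
    unfolding indep_vars_def2
  proof (intro conjI ballI)
    let ?F = "\<lambda>j. {Y j -` A \<inter> space M |A. A \<in> sets borel}"
    show "indep_sets (\<lambda>j. ?F (i + j)) UNIV"
      unfolding indep_sets_def
    proof (intro conjI ballI allI impI)
      fix J :: "nat set" and A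
      assume J: "J \<noteq> {}" "finite J" and A: "A \<in> (\<Pi> j\<in>J. ?F (i + j))"
      have F: "indep_sets ?F UNIV" using indep by (simp add: indep_vars_def2)
      \<comment> \<open>Independence of the shifted family over \<open>J\<close> is that of the
        original family over the translate of \<open>J\<close> by \<open>i\<close>;
        \<open>j - i\<close> undoes the translation.\<close>
      have "prob (\<Inter>j\<in>(+) i ` J. A (j - i)) = (\<Prod>j\<in>(+) i ` J. prob (A (j - i)))"
        using J A by (intro indep_setsD[OF F]) auto
      then show "prob (\<Inter>j\<in>J. A j) = (\<Prod>j\<in>J. prob (A j))"
        by (simp add: prod.reindex)
    qed auto
  qed simp
  then have "distr M (\<Pi>\<^sub>M j\<in>UNIV. borel) (\<lambda>\<omega>. \<lambda>j\<in>UNIV. Y (i + j) \<omega>) =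
      (\<Pi>\<^sub>M j\<in>UNIV. distr M borel (Y (i + j)))"
    by (subst (asm) indep_vars_iff_distr_eq_PiM) auto
  moreover have "distr M (\<Pi>\<^sub>M j\<in>UNIV. borel) (\<lambda>\<omega>. \<lambda>j\<in>UNIV. Y j \<omega>) = (\<Pi>\<^sub>M j\<in>UNIV. distr M borel (Y j))"
    using indep by (subst (asm) indep_vars_iff_distr_eq_PiM) auto
  moreover have "(\<lambda>j. distr M borel (Y (i + j))) = (\<lambda>j. distr M borel (Y j))"
    by (intro ext) (metis distr_Y)
  ultimately show ?thesis by (simp add: restrict_UNIV)
qed

text \<open>Both events are preimages of one measurable set \<open>A\<close> of sequences, under the
  shifted and the unshifted sequence, and these have the same law.\<close>

lemma prob_heavy_start:
  "prob {\<omega>\<in>space M. i \<in> heavy_starts (\<lambda>j. Y j \<omega>) c N} =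
    prob {\<omega>\<in>space M. 0 \<in> heavy_starts (\<lambda>j. Y j \<omega>) c N}"
proof -
  let ?P = "\<Pi>\<^sub>M j\<in>(UNIV :: nat set). (borel :: real measure)"
  define A where "A = {y\<in>space ?P. 0 \<in> heavy_starts y c N}"
  have "(\<lambda>y. \<Sum>j<n. y (0 + j)) \<in> borel_measurable ?P" for n
    by (intro borel_measurable_sum measurable_component_singleton) simp
  then have A [measurable]: "A \<in> sets ?P"
    unfolding A_def heavy_starts_def mem_Collect_eq
    by (intro sets.sets_Collect_finite_Ex borel_measurable_less borel_measurable_const) simp_all
  have "prob {\<omega>\<in>space M. k \<in> heavy_starts (\<lambda>j. Y j \<omega>) c N} = measure (distr M ?P (\<lambda>\<omega> j. Y (k + j) \<omega>)) A" for k
  proof -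
    have "(\<lambda>\<omega> j. Y (k + j) \<omega>) \<in> measurable M ?P"
      by (rule measurable_PiM_single') auto
    then show ?thesis
      by (subst measure_distr[OF _ A]) (auto simp: A_def space_PiM heavy_starts_def intro!: arg_cong[where f = prob])
  qed
  from this[of i] this[of 0] show ?thesis using distr_shift[of i] by simp
qed

lemma integrable_Y: "integrable M (Y 0) \<Longrightarrow> integrable M (Y i)"
proof -
  have "integrable (distr M borel (Y i)) (\<lambda>x. x) \<longleftrightarrow> integrable M (Y i)" for i
    by (rule integrable_distr_eq) (rule measurable_Y, simp)
  then show "integrable M (Y 0) \<Longrightarrow> integrable M (Y i)"
    by (metis distr_Y)
qed

lemma expectation_Y: "expectation (Y i) = expectation (Y 0)"
proof -
  have "integral\<^sup>L (distr M borel (Y i)) (\<lambda>x. x) = expectation (Y i)" for i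
    by (rule integral_distr) (rule measurable_Y, simp)
  then show ?thesis
    by (metis distr_Y)
qed

text \<open>
  Average the covering bound over the starts below \<open>K\<close>, which are equally likely to be heavy by
  stationarity, and let \<open>K\<close> tend to infinity to get rid of the overhang \<open>N\<close>.
\<close>

lemma prob_heavy_start_le:
  assumes int: "integrable M (Y 0)" and "0 \<le> c"
  shows "c * prob {\<omega>\<in>space M. 0 \<in> heavy_starts (\<lambda>j. Y j \<omega>) c N} \<le> expectation (Y 0)"
proof -
  define E where "E i = {\<omega>\<in>space M. i \<in> heavy_starts (\<lambda>j. Y j \<omega>) c N}" for i
  have E [measurable]: "E i \<in> sets M" for i
    unfolding heavy_starts_def E_def by simp
  have int_E: "integrable M (indicat_real (E i))" for i
    using E by (intro integrable_real_indicator) (simp_all add: emeasure_eq_measure)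
  have *: "c * prob (E 0) \<le> (1 + N / K) * expectation (Y 0)" if "0 < K" for K :: nat
  proof -
    have pointwise: "c * (\<Sum>i<K. indicator (E i) \<omega>) \<le> (\<Sum>j<K + N. Y j \<omega>)" if "\<omega> \<in> space M" for \<omega>
    proof -
      have "(\<Sum>i<K. indicator (E i) \<omega>) = real (card (heavy_starts (\<lambda>j. Y j \<omega>) c N \<inter> {0..<K}))"
        using that by (simp add: E_def indicator_def sum.If_cases lessThan_atLeast0 Int_commute Int_def conj_commute)
      then show ?thesis
        using card_heavy_starts_le[of "\<lambda>j. Y j \<omega>" c N 0 K] nonneg \<open>0 \<le> c\<close>
        by (simp add: lessThan_atLeast0)
    qed
    have "c * (real K * prob (E 0)) = c * (\<Sum>i<K. prob (E i))"
      unfolding E_def by (subst sum.cong[OF refl prob_heavy_start]) simp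
    also have "\<dots> = c * (\<Sum>i<K. expectation (indicator (E i)))"
      using sets.sets_into_space[OF E] by (simp add: Int_absorb2)
    also have "\<dots> = expectation (\<lambda>\<omega>. c * (\<Sum>i<K. indicator (E i) \<omega>))"
      by (subst integral_mult_right_zero, subst Bochner_Integration.integral_sum) (use int_E in auto)
    also have "\<dots> \<le> expectation (\<lambda>\<omega>. \<Sum>j<K + N. Y j \<omega>)"
      by (intro integral_mono integrable_mult_right Bochner_Integration.integrable_sum
          integrable_Y[OF int] int_E pointwise)
    also have "\<dots> = (\<Sum>j<K + N. expectation (Y j))"
      by (intro Bochner_Integration.integral_sum integrable_Y[OF int])
    also have "\<dots> = (\<Sum>j<K + N. expectation (Y 0))"
      by (intro sum.cong refl expectation_Y)
    finally show ?thesis using that by (simp add: field_simps)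
  qed
  have "(\<lambda>K. (1 + real N / real K) * expectation (Y 0)) \<longlonglongrightarrow> (1 + 0) * expectation (Y 0)"
    by (intro tendsto_intros lim_const_over_n)
  then have "(\<lambda>K. (1 + real N / real K) * expectation (Y 0)) \<longlonglongrightarrow> expectation (Y 0)"
    by simp
  then have "c * prob (E 0) \<le> expectation (Y 0)"
    by (rule LIMSEQ_le_const) (use * in \<open>auto intro!: exI[of _ 1]\<close>)
  then show ?thesis by (simp add: E_def)
qed

text \<open>The capped events increase with \<open>N\<close> to the uncapped one and the bound does
  not depend on \<open>N\<close>, so continuity from below gives the limit.\<close>

lemma maximal_inequality:
  assumes int: "integrable M (Y 0)" and "0 \<le> c"
  shows "c * prob {\<omega>\<in>space M. \<exists>n\<ge>1. c * real n < (\<Sum>j<n. Y j \<omega>)} \<le> expectation (Y 0)"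
proof -
  let ?E = "\<lambda>N. {\<omega>\<in>space M. 0 \<in> heavy_starts (\<lambda>j. Y j \<omega>) c N}"
  have [measurable]: "?E N \<in> sets M" for N
    unfolding heavy_starts_def by simp
  have "(\<lambda>N. prob (?E N)) \<longlonglongrightarrow> prob (\<Union>N. ?E N)"
    by (intro finite_Lim_measure_incseq) (auto simp: incseq_def heavy_starts_def intro: order_trans)
  then have "(\<lambda>N. c * prob (?E N)) \<longlonglongrightarrow> c * prob (\<Union>N. ?E N)"
    by (intro tendsto_intros)
  then have "c * prob (\<Union>N. ?E N) \<le> expectation (Y 0)"
    by (rule LIMSEQ_le_const2) (auto intro: prob_heavy_start_le[OF assms])
  also have "(\<Union>N. ?E N) = {\<omega>\<in>space M. \<exists>n\<ge>1. c * real n < (\<Sum>j<n. Y j \<omega>)}"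
    by (fastforce simp: heavy_starts_def)
  finally show ?thesis .
qed

section \<open>The strong law for bounded variables and its one-sided extensions by
  truncation\<close>

lemma strong_law_bounded:
  assumes bound: "\<And>\<omega>. Y 0 \<omega> \<le> T" and "0 < \<epsilon>"
  shows "AE \<omega> in M. \<forall>\<^sub>F n in sequentially. \<bar>(\<Sum>j<n. Y j \<omega>) / n - expectation (Y 0)\<bar> < \<epsilon>"
proof -
  \<comment> \<open>Hoeffding's inequality for the range \<open>{0..b}\<close> gives the tail
    \<open>2 * r ^ n\<close>; the added 1 keeps \<open>b\<close> positive even for
    \<open>T = 0\<close>.\<close>
  define b where "b = max T 0 + 1"
  define r where "r = exp (- 2 * \<epsilon>\<^sup>2 / b\<^sup>2)"
  have b: "0 < b" by (simp add: b_def)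
  have r: "0 < r" "r < 1" using \<open>0 < \<epsilon>\<close> b by (simp_all add: r_def)
  let ?A = "\<lambda>n. {\<omega>\<in>space M. \<bar>(\<Sum>j<n. Y j \<omega>) / n - expectation (Y 0)\<bar> \<ge> \<epsilon>}"
  have le: "prob (?A n) \<le> 2 * r ^ n" if "0 < n" for n
  proof -
    interpret Hoeffding_ineq_iid M "{..<n}" Y "Y 0" 0 b "expectation (Y 0)"
    proof unfold_locales
      show "indep_vars (\<lambda>_. borel) Y {..<n}" using indep by (rule indep_vars_subset) simp
      show "AE \<omega> in M. Y 0 \<omega> \<in> {0..b}"
        using bound nonneg by (auto simp: b_def intro!: AE_I2 order_trans[OF bound])
    qed (rule distr_Y | simp)+
    have "{..<n} \<noteq> {}" using that by auto
    then show ?thesis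
      using Hoeffding_ineq_abs_ge'[of \<epsilon>] \<open>0 < \<epsilon>\<close> b
      by (simp add: r_def exp_of_nat_mult[symmetric] field_simps)
  qed
  have "AE \<omega> in M. \<forall>\<^sub>F n in sequentially. \<omega> \<in> space M - ?A n"
  proof (rule borel_cantelli_AE1)
    have "summable (\<lambda>n. 2 * r ^ n)"
      using r by (intro summable_mult summable_geometric) simp
    \<comment> \<open>The tail bound holds for \<open>0 < n\<close>, so the comparison with the
      geometric series starts at index 1.\<close>
    then show "summable (\<lambda>n. prob (?A n))"
      by (rule summable_comparison_test'[of _ 1]) (simp add: le)
  qed (simp_all add: emeasure_eq_measure)
  then show ?thesis
    by eventually_elim (auto elim!: eventually_mono)
qed

text \<open>The mean is a nonnegative integral because it may be infinite. By monotone convergence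
  some truncation already has mean above \<open>c\<close>, and truncating only lowers sample
  means.\<close>

lemma strong_law_lower:
  assumes "ennreal c < (\<integral>\<^sup>+\<omega>. ennreal (Y 0 \<omega>) \<partial>M)" and "0 \<le> c"
  shows "AE \<omega> in M. \<forall>\<^sub>F n in sequentially. c < (\<Sum>j<n. Y j \<omega>) / n"
proof -
  have "(\<integral>\<^sup>+\<omega>. ennreal (Y 0 \<omega>) \<partial>M) = (\<integral>\<^sup>+\<omega>. (SUP T::nat. ennreal (min (Y 0 \<omega>) T)) \<partial>M)"
  proof (intro nn_integral_cong antisym)
    fix \<omega>
    obtain T :: nat where "Y 0 \<omega> \<le> T" using real_arch_simple by blast
    then show "ennreal (Y 0 \<omega>) \<le> (SUP T::nat. ennreal (min (Y 0 \<omega>) T))"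
      by (intro SUP_upper2[of T]) auto
  qed (auto intro!: SUP_least ennreal_leI)
  also have "\<dots> = (SUP T::nat. \<integral>\<^sup>+\<omega>. ennreal (min (Y 0 \<omega>) T) \<partial>M)"
    by (intro nn_integral_monotone_convergence_SUP)
      (auto simp: incseq_def le_fun_def intro!: ennreal_leI)
  finally obtain T :: nat where T: "ennreal c < (\<integral>\<^sup>+\<omega>. ennreal (min (Y 0 \<omega>) T) \<partial>M)"
    using assms by (auto simp: less_SUP_iff)
  interpret trunc: iid_nonneg M "\<lambda>i \<omega>. min (Y i \<omega>) T"
    by (rule iid_nonneg_compose[of "\<lambda>x. min x (real T)"]) auto
  have int: "integrable M (\<lambda>\<omega>. min (Y 0 \<omega>) T)"
    by (rule integrable_const_bound[where B = T]) (simp_all add: nonneg abs_of_nonneg)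
  define m where "m = expectation (\<lambda>\<omega>. min (Y 0 \<omega>) T)"
  have "c < m"
    using T \<open>0 \<le> c\<close> by (simp add: m_def nn_integral_eq_integral int nonneg ennreal_less_iff)
  \<comment> \<open>The tolerance \<open>m - c\<close> puts the lower end of the interval around
    \<open>m\<close> exactly at \<open>c\<close>.\<close>
  have "AE \<omega> in M. \<forall>\<^sub>F n in sequentially. \<bar>(\<Sum>j<n. min (Y j \<omega>) T) / n - m\<bar> < m - c"
    unfolding m_def using \<open>c < m\<close> by (intro trunc.strong_law_bounded[of T]) (auto simp: m_def)
  then show ?thesis
  proof eventually_elim
    case (elim \<omega>)
    then show ?case
    proof eventually_elim
      case (elim n)
      have "(\<Sum>j<n. min (Y j \<omega>) T) / n \<le> (\<Sum>j<n. Y j \<omega>) / n"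
        by (intro divide_right_mono sum_mono) auto
      then show ?case using elim by linarith
    qed
  qed
qed

text \<open>Dominated convergence with majorant \<open>Y 0\<close>: at each point the excess
  vanishes once \<open>T\<close> reaches the value there.\<close>

lemma exists_small_excess:
  assumes int: "integrable M (Y 0)" and "0 < \<delta>"
  shows "\<exists>T::nat. expectation (\<lambda>\<omega>. Y 0 \<omega> - min (Y 0 \<omega>) T) < \<delta>"
proof -
  have "(\<lambda>T::nat. expectation (\<lambda>\<omega>. Y 0 \<omega> - min (Y 0 \<omega>) T)) \<longlonglongrightarrow> expectation (\<lambda>_. 0)"
  proof (rule integral_dominated_convergence[OF _ _ int])
    show "AE \<omega> in M. (\<lambda>T::nat. Y 0 \<omega> - min (Y 0 \<omega>) T) \<longlonglongrightarrow> 0"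
    proof (intro AE_I2 tendsto_eventually)
      fix \<omega>
      show "\<forall>\<^sub>F T::nat in sequentially. Y 0 \<omega> - min (Y 0 \<omega>) T = 0"
        using eventually_ge_at_top[of "nat \<lceil>Y 0 \<omega>\<rceil>"] by eventually_elim (simp add: ceiling_le_iff)
    qed
  qed (auto simp: nonneg abs_if min_def)
  then have "\<forall>\<^sub>F T::nat in sequentially. expectation (\<lambda>\<omega>. Y 0 \<omega> - min (Y 0 \<omega>) T) < \<delta>"
    using \<open>0 < \<delta>\<close> by (intro order_tendstoD) auto
  then show ?thesis by (auto simp: eventually_sequentially)
qed

text \<open>Split each variable into truncation and excess. The truncated sample means settle near a
  mean of at most \<open>expectation (Y 0)\<close>; the excess means stay small for all
  \<open>n\<close> at once off an event of arbitrarily small probability.\<close>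

lemma strong_law_upper:
  assumes int: "integrable M (Y 0)" and less: "expectation (Y 0) < c"
  shows "AE \<omega> in M. \<forall>\<^sub>F n in sequentially. (\<Sum>j<n. Y j \<omega>) / n \<le> c"
proof -
  \<comment> \<open>Half the gap: one \<open>\<epsilon>\<close> is spent on the truncated part, the
    other on the excess.\<close>
  define \<epsilon> where "\<epsilon> = (c - expectation (Y 0)) / 2"
  have \<epsilon>: "0 < \<epsilon>" using less by (simp add: \<epsilon>_def)
  let ?bad = "{\<omega>\<in>space M. \<not> (\<forall>\<^sub>F n in sequentially. (\<Sum>j<n. Y j \<omega>) / n \<le> c)}"
  have "prob ?bad \<le> 0"
  proof (rule field_le_epsilon)
    fix \<delta> :: real assume "0 < \<delta>"
    \<comment> \<open>The maximal inequality at level \<open>\<epsilon>\<close> divides this bound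
      by \<open>\<epsilon>\<close>, which leaves \<open>\<delta>\<close>.\<close>
    obtain T :: nat where T: "expectation (\<lambda>\<omega>. Y 0 \<omega> - min (Y 0 \<omega>) T) < \<epsilon> * \<delta>"
      using exists_small_excess[OF int, of "\<epsilon> * \<delta>"] \<epsilon> \<open>0 < \<delta>\<close> by auto
    interpret trunc: iid_nonneg M "\<lambda>i \<omega>. min (Y i \<omega>) T"
      by (rule iid_nonneg_compose[of "\<lambda>x. min x (real T)"]) auto
    interpret excess: iid_nonneg M "\<lambda>i \<omega>. Y i \<omega> - min (Y i \<omega>) T"
      by (rule iid_nonneg_compose[of "\<lambda>x. x - min x (real T)"]) auto
    let ?E = "{\<omega>\<in>space M. \<exists>n\<ge>1. \<epsilon> * real n < (\<Sum>j<n. Y j \<omega> - min (Y j \<omega>) T)}"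
    have int': "integrable M (\<lambda>\<omega>. min (Y 0 \<omega>) T)"
      by (rule integrable_const_bound[where B = T]) (simp_all add: nonneg abs_of_nonneg)
    have "\<epsilon> * prob ?E \<le> expectation (\<lambda>\<omega>. Y 0 \<omega> - min (Y 0 \<omega>) T)"
      using int int' \<epsilon> by (intro excess.maximal_inequality) auto
    with T have "\<epsilon> * prob ?E \<le> \<epsilon> * \<delta>" by linarith
    then have E: "prob ?E \<le> \<delta>" using \<epsilon> by simp
    have le: "expectation (\<lambda>\<omega>. min (Y 0 \<omega>) T) \<le> expectation (Y 0)"
      using int int' by (intro integral_mono) auto
    have good: "\<forall>\<^sub>F n in sequentially. (\<Sum>j<n. Y j \<omega>) / n \<le> c"
      if ev: "\<forall>\<^sub>F n in sequentially.
          \<bar>(\<Sum>j<n. min (Y j \<omega>) T) / n - expectation (\<lambda>\<omega>. min (Y 0 \<omega>) T)\<bar> < \<epsilon>"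
        and "\<omega> \<in> space M" "\<omega> \<notin> ?E" for \<omega>
      using ev eventually_ge_at_top[of 1]
    proof eventually_elim
      case (elim n)
      then have "(\<Sum>j<n. Y j \<omega> - min (Y j \<omega>) T) \<le> \<epsilon> * n" using that by auto
      then have "(\<Sum>j<n. Y j \<omega>) / n - (\<Sum>j<n. min (Y j \<omega>) T) / n \<le> \<epsilon>"
        using elim by (simp add: sum_subtractf divide_le_eq flip: diff_divide_distrib)
      moreover have "c = expectation (Y 0) + 2 * \<epsilon>" by (simp add: \<epsilon>_def field_simps)
      ultimately show ?case using elim le by linarith
    qed
    have "AE \<omega> in M. \<forall>\<^sub>F n in sequentially.
        \<bar>(\<Sum>j<n. min (Y j \<omega>) T) / n - expectation (\<lambda>\<omega>. min (Y 0 \<omega>) T)\<bar> < \<epsilon>"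
      using \<epsilon> by (intro trunc.strong_law_bounded[of T]) auto
    then have "AE \<omega> in M. \<omega> \<in> ?bad \<longrightarrow> \<omega> \<in> ?E"
      by (rule eventually_mono) (use good in blast)
    then have "prob ?bad \<le> prob ?E" by (intro finite_measure_mono_AE) auto
    then show "prob ?bad \<le> 0 + \<delta>" using E by simp
  qed
  then have "prob ?bad = 0" by (simp add: measure_le_0_iff)
  then show ?thesis by (subst AE_iff_measurable[OF _ refl]) (auto simp: emeasure_eq_measure)
qed

end

section \<open>Orlicz norms\<close>

lemma orlicz_function_mono: "orlicz_function \<psi> \<Longrightarrow> 0 \<le> x \<Longrightarrow> x \<le> y \<Longrightarrow> \<psi> x \<le> \<psi> y"
  by (auto simp: orlicz_function_def mono_on_def)

lemma orlicz_function_nonneg: "orlicz_function \<psi> \<Longrightarrow> 0 \<le> x \<Longrightarrow> 0 \<le> \<psi> x"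
  by (auto simp: orlicz_function_def)

lemma orlicz_function_scale_le:
  assumes "orlicz_function \<psi>" "0 \<le> t" "t \<le> 1" "0 \<le> x"
  shows "\<psi> (t * x) \<le> t * \<psi> x"
proof -
  have "convex_on {0..} \<psi>" and "\<psi> 0 = 0"
    using assms by (auto simp: orlicz_function_def)
  then show ?thesis using convex_onD[of "{0..}" \<psi> t 0 x] assms by simp
qed

lemma borel_measurable_orlicz:
  fixes \<sigma> :: real
  assumes "orlicz_function \<psi>" and "0 < \<sigma>"
  shows "(\<lambda>v::'b::real_normed_vector. \<psi> (norm v / \<sigma>)) \<in> borel_measurable borel"
proof -
  \<comment> \<open>Nothing is known about \<open>\<psi>\<close> at negative arguments; composing
    with \<open>max 0\<close> gives a function monotone on the whole line, hence Borel.\<close>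
  have "(\<lambda>x. \<psi> (max 0 x)) \<in> borel_measurable borel"
    by (intro borel_measurable_mono monoI orlicz_function_mono[OF assms(1)]) auto
  moreover have "(\<lambda>v::'b. norm v / \<sigma>) \<in> borel_measurable borel"
    using assms by (intro borel_measurable_continuous_onI continuous_intros) auto
  ultimately have "(\<lambda>x. \<psi> (max 0 x)) \<circ> (\<lambda>v::'b. norm v / \<sigma>) \<in> borel_measurable borel"
    by (rule measurable_comp[rotated])
  then show ?thesis using assms by (simp add: comp_def)
qed

section \<open>Comparing a threshold with the empirical and the population norm\<close>

lemma empirical_orlicz_norm_le:
  assumes "0 < \<sigma>" and "(\<Sum>i<n. \<psi> (norm (x i) / \<sigma>)) / n \<le> 1"
  shows "empirical_orlicz_norm \<psi> n x \<le> ennreal \<sigma>"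
  unfolding empirical_orlicz_norm_def using assms by (intro Inf_lower) auto

text \<open>An admissible \<open>\<tau>\<close> below \<open>\<sigma>\<close> is impossible: since
  \<open>\<psi>\<close> is monotone, the sample mean at \<open>\<sigma>\<close> would be at most the
  one at \<open>\<tau>\<close>, hence at most 1.\<close>

lemma le_empirical_orlicz_norm:
  assumes \<psi>: "orlicz_function \<psi>" and "1 < (\<Sum>i<n. \<psi> (norm (x i) / \<sigma>)) / n"
  shows "ennreal \<sigma> \<le> empirical_orlicz_norm \<psi> n x"
  unfolding empirical_orlicz_norm_def
proof (rule Inf_greatest, clarify)
  fix \<tau> :: real
  assume \<tau>: "0 < \<tau>" "1 / real n * (\<Sum>i<n. \<psi> (norm (x i) / \<tau>)) \<le> 1"
  show "ennreal \<sigma> \<le> ennreal \<tau>"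
  proof (rule ccontr)
    assume "\<not> ennreal \<sigma> \<le> ennreal \<tau>"
    then have "\<tau> < \<sigma>" by (meson ennreal_leI not_le)
    then have "(\<Sum>i<n. \<psi> (norm (x i) / \<sigma>)) / n \<le> (\<Sum>i<n. \<psi> (norm (x i) / \<tau>)) / n"
      using \<tau> by (intro divide_right_mono sum_mono orlicz_function_mono[OF \<psi>] frac_le) auto
    then show False using \<tau> assms by simp
  qed
qed

text \<open>Some admissible \<open>\<tau>\<close> lies strictly below \<open>\<sigma>\<close>, and
  scaling by convexity gains the factor \<open>\<tau> / \<sigma> < 1\<close>. The strict inequality
  is what the strong law needs as a margin.\<close>

lemma nn_integral_orlicz_less_one:
  assumes \<psi>: "orlicz_function \<psi>" and [measurable]: "X \<in> borel_measurable N"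
    and "orlicz_norm \<psi> N X < ennreal \<sigma>"
  shows "(\<integral>\<^sup>+\<omega>. ennreal (\<psi> (norm (X \<omega>) / \<sigma>)) \<partial>N) < 1"
proof -
  obtain \<tau> where \<tau>: "0 < \<tau>" "(\<integral>\<^sup>+\<omega>. ennreal (\<psi> (norm (X \<omega>) / \<tau>)) \<partial>N) \<le> 1" "ennreal \<tau> < ennreal \<sigma>"
    using assms unfolding orlicz_norm_def Inf_less_iff by auto
  then have less: "\<tau> < \<sigma>" by (simp add: ennreal_less_iff)
  note [measurable] = borel_measurable_orlicz[OF \<psi> \<open>0 < \<tau>\<close>]
  have "\<psi> (norm v / \<sigma>) \<le> (\<tau> / \<sigma>) * \<psi> (norm v / \<tau>)" for v :: 'b
    using orlicz_function_scale_le[OF \<psi>, of "\<tau> / \<sigma>" "norm v / \<tau>"] \<tau> less by simp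
  then have "(\<integral>\<^sup>+\<omega>. ennreal (\<psi> (norm (X \<omega>) / \<sigma>)) \<partial>N)
      \<le> (\<integral>\<^sup>+\<omega>. ennreal (\<tau> / \<sigma>) * ennreal (\<psi> (norm (X \<omega>) / \<tau>)) \<partial>N)"
    using \<tau> less by (intro nn_integral_mono)
      (simp add: ennreal_mult[symmetric] orlicz_function_nonneg[OF \<psi>] ennreal_leI)
  also have "\<dots> = ennreal (\<tau> / \<sigma>) * (\<integral>\<^sup>+\<omega>. ennreal (\<psi> (norm (X \<omega>) / \<tau>)) \<partial>N)"
    by (intro nn_integral_cmult) simp
  also have "\<dots> \<le> ennreal (\<tau> / \<sigma>) * 1"
    using \<tau> by (intro mult_left_mono) auto
  also have "\<dots> < 1" using \<tau> less by (simp add: ennreal_less_one_iff)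
  finally show ?thesis .
qed

lemma nn_integral_orlicz_greater_one:
  assumes "0 < \<sigma>" and "ennreal \<sigma> < orlicz_norm \<psi> N X"
  shows "1 < (\<integral>\<^sup>+\<omega>. ennreal (\<psi> (norm (X \<omega>) / \<sigma>)) \<partial>N)"
proof (rule ccontr)
  assume "\<not> ?thesis"
  then have "orlicz_norm \<psi> N X \<le> ennreal \<sigma>"
    unfolding orlicz_norm_def using assms by (intro Inf_lower) (auto simp: not_less)
  then show False using assms by simp
qed

section \<open>Almost sure convergence of the empirical norm\<close>

theorem theorem2p1:
  fixes \<psi> :: "real \<Rightarrow> real"
    and N :: "'c measure" and X :: "'c \<Rightarrow> 'b::banach"
    and M :: "'a measure" and Xs :: "nat \<Rightarrow> 'a \<Rightarrow> 'b"
  assumes "orlicz_function \<psi>"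
    and "prob_space N" and "X \<in> borel_measurable N"
    and "orlicz_norm \<psi> N X < \<infinity>"
    and "prob_space M"
    and "prob_space.indep_vars M (\<lambda>_. borel) Xs UNIV"
    and "\<And>i. distr M borel (Xs i) = distr N borel X"
  shows "AE \<omega> in M. (\<lambda>n. empirical_orlicz_norm \<psi> n (\<lambda>i. Xs i \<omega>)) \<longlonglongrightarrow> orlicz_norm \<psi> N X"
proof -
  interpret M: prob_space M by fact
  note \<psi> = assms(1) and X [measurable] = assms(3)
  let ?s = "orlicz_norm \<psi> N X"
  let ?e = "\<lambda>n \<omega>. empirical_orlicz_norm \<psi> n (\<lambda>i. Xs i \<omega>)"
  have Xs [measurable]: "Xs i \<in> borel_measurable M" for i
    using assms(6) by (auto simp: M.indep_vars_def)
  have iid: "iid_nonneg M (\<lambda>i \<omega>. \<psi> (norm (Xs i \<omega>) / \<sigma>))" if "0 < \<sigma>" for \<sigma>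
  proof
    note g [measurable] = borel_measurable_orlicz[OF \<psi> that, where 'b = 'b]
    show "M.indep_vars (\<lambda>_. borel) (\<lambda>i \<omega>. \<psi> (norm (Xs i \<omega>) / \<sigma>)) UNIV"
      by (rule M.indep_vars_compose2[OF assms(6)]) simp
    show "distr M borel (\<lambda>\<omega>. \<psi> (norm (Xs i \<omega>) / \<sigma>)) = distr M borel (\<lambda>\<omega>. \<psi> (norm (Xs 0 \<omega>) / \<sigma>))" for i
      using arg_cong[OF trans[OF assms(7)[of i] assms(7)[of 0, symmetric]],
          of "\<lambda>D. distr D borel (\<lambda>v. \<psi> (norm v / \<sigma>))"]
      by (simp add: distr_distr comp_def)
  qed (use that in \<open>simp add: orlicz_function_nonneg[OF \<psi>]\<close>)
  \<comment> \<open>\<open>X\<close> and its copies live on different spaces; both integrals are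
    integrals against the common law.\<close>
  have same: "(\<integral>\<^sup>+\<omega>. ennreal (\<psi> (norm (Xs 0 \<omega>) / \<sigma>)) \<partial>M) = (\<integral>\<^sup>+\<omega>. ennreal (\<psi> (norm (X \<omega>) / \<sigma>)) \<partial>N)"
    if "0 < \<sigma>" for \<sigma>
  proof -
    note g [measurable] = borel_measurable_orlicz[OF \<psi> that, where 'b = 'b]
    have "(\<integral>\<^sup>+\<omega>. ennreal (\<psi> (norm (Xs 0 \<omega>) / \<sigma>)) \<partial>M) = (\<integral>\<^sup>+v. ennreal (\<psi> (norm v / \<sigma>)) \<partial>distr M borel (Xs 0))"
      by (simp add: nn_integral_distr)
    also have "\<dots> = (\<integral>\<^sup>+\<omega>. ennreal (\<psi> (norm (X \<omega>) / \<sigma>)) \<partial>N)"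
      by (simp add: assms(7) nn_integral_distr)
    finally show ?thesis .
  qed
  have upper: "AE \<omega> in M. \<forall>\<^sub>F n in sequentially. ?e n \<omega> \<le> ennreal \<sigma>" if "0 < \<sigma>" "?s < ennreal \<sigma>" for \<sigma>
  proof -
    interpret iid_nonneg M "\<lambda>i \<omega>. \<psi> (norm (Xs i \<omega>) / \<sigma>)" by (rule iid) fact
    have less: "(\<integral>\<^sup>+\<omega>. ennreal (\<psi> (norm (Xs 0 \<omega>) / \<sigma>)) \<partial>M) < 1"
      using that by (simp add: same nn_integral_orlicz_less_one[OF \<psi>])
    \<comment> \<open>Above the norm the mean is finite, which supplies the integrability required
      by the upper law.\<close>
    have int: "integrable M (\<lambda>\<omega>. \<psi> (norm (Xs 0 \<omega>) / \<sigma>))"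
      using less by (intro integrableI_nonneg) (auto simp: nonneg intro: less_trans)
    then have "M.expectation (\<lambda>\<omega>. \<psi> (norm (Xs 0 \<omega>) / \<sigma>)) < 1"
      using less by (simp add: nn_integral_eq_integral nonneg ennreal_less_one_iff)
    from strong_law_upper[OF int this] show ?thesis
      by eventually_elim (auto elim!: eventually_mono intro!: empirical_orlicz_norm_le that)
  qed
  have lower: "AE \<omega> in M. \<forall>\<^sub>F n in sequentially. ennreal \<sigma> \<le> ?e n \<omega>" if "0 < \<sigma>" "ennreal \<sigma> < ?s" for \<sigma>
  proof -
    interpret iid_nonneg M "\<lambda>i \<omega>. \<psi> (norm (Xs i \<omega>) / \<sigma>)" by (rule iid) fact
    \<comment> \<open>Below the norm the mean may be infinite, which the lower law allows.\<close>
    have "AE \<omega> in M. \<forall>\<^sub>F n in sequentially. 1 < (\<Sum>j<n. \<psi> (norm (Xs j \<omega>) / \<sigma>)) / n"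
      using that by (intro strong_law_lower) (simp_all add: same nn_integral_orlicz_greater_one)
    then show ?thesis
      by eventually_elim (auto elim!: eventually_mono intro!: le_empirical_orlicz_norm[OF \<psi>])
  qed
  have "AE \<omega> in M. \<forall>q::rat. 0 < real_of_rat q \<longrightarrow>
      (?s < ennreal (real_of_rat q) \<longrightarrow> (\<forall>\<^sub>F n in sequentially. ?e n \<omega> \<le> ennreal (real_of_rat q))) \<and>
      (ennreal (real_of_rat q) < ?s \<longrightarrow> (\<forall>\<^sub>F n in sequentially. ennreal (real_of_rat q) \<le> ?e n \<omega>))"
    using upper lower by (simp add: AE_all_countable)
  then show ?thesis
  proof eventually_elim
    case (elim \<omega>)
    show ?case
    \<comment> \<open>Convergence in the order topology of \<open>ennreal\<close>; if the norm is 0,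
      the lower half is vacuous.\<close>
    proof (rule order_tendstoI)
      fix a assume "a < ?s"
      then obtain q where q: "a < ennreal (real_of_rat q)" "ennreal (real_of_rat q) < ?s"
        using ennreal_rat_dense by blast
      \<comment> \<open>\<open>ennreal\<close> sends nonpositive reals to 0, so a value strictly
        above \<open>a\<close> forces \<open>q\<close> to be positive.\<close>
      then have "0 < real_of_rat q" using order.strict_trans1[OF zero_le q(1)] by simp
      with elim q have "\<forall>\<^sub>F n in sequentially. ennreal (real_of_rat q) \<le> ?e n \<omega>" by blast
      then show "\<forall>\<^sub>F n in sequentially. a < ?e n \<omega>"
        by eventually_elim (use q in order)
    next
      fix a assume "?s < a"
      then obtain q where q: "?s < ennreal (real_of_rat q)" "ennreal (real_of_rat q) < a"
        using ennreal_rat_dense by blast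
      then have "0 < real_of_rat q" using order.strict_trans1[OF zero_le q(1)] by simp
      with elim q have "\<forall>\<^sub>F n in sequentially. ?e n \<omega> \<le> ennreal (real_of_rat q)" by blast
      then show "\<forall>\<^sub>F n in sequentially. ?e n \<omega> < a"
        by eventually_elim (use q in order)
    qed
  qed
qed

end
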